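(* The following equality holds: $$\min\Big\{1,\ \min_{T\in\mathcal{T}}\Big(1-\frac{|T|-r}{S_T}\Big)\Big\}=1-\frac{1}{z^*_{(\mathcal{P})}}.$$
   Context: Setting: $\mathcal{U}$ is a finite set of components and $\mathcal{X}$ a finite set of sensor locations. Each $u\in\mathcal{U}$ has a security level $\varphi_u\in[0,1)$. Each $x\in\mathcal{X}$ has a nonempty monitoring set $U_x\subseteq\mathcal{U}$; for $C\subseteq\mathcal{X}$, $U_C=\bigcup_{x\in C}U_x$; every component belongs to at least one monitoring set, i.e. $U_{\mathcal{X}}=\mathcal{U}$. A set cover is a $C\subseteq\mathcal{X}$ with $U_C=\mathcal{U}$, and $n^*$ is the minimum size of a set cover. The number of sensors is a positive integer $r$ with $r<n^*$. A set packing is a $T\subseteq\mathcal{U}$ with $|T\cap U_x|\le1$ for all $x\in\mathcal{X}$; $\mathcal{T}$ is the collection of set packings. For $T\subseteq\mathcal{U}$, $S_T=\sum_{u\in T}(1-\varphi_u)^{-1}$. For $T=\emptyset$ the quantity $1-\frac{|T|-r}{S_T}$ is read as $+\infty$. Problem $(\mathcal{P})$, with optimal value $z^*_{(\mathcal{P})}$, is the mixed-integer program over $t_l\in\mathbb{R}$ and $z_l\in\{0,1\}$ for $l\in\{r+1,\dots,|\mathcal{U}|\}$, and $y_u\in\{0,1\}$ for $u\in\mathcal{U}$: minimize $\sum_{l=r+1}^{|\mathcal{U}|}\frac{1}{l-r}t_l$ subject to - $\sum_{u\in U_x}y_u\le1$ for all $x\in\mathcal{X}$; - $\sum_{u\in\mathcal{U}}y_u=\sum_{l=r+1}^{|\mathcal{U}|}l\,z_l$;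 - $\sum_{l=r+1}^{|\mathcal{U}|}z_l=1$; - $t_l\ge\sum_{u\in\mathcal{U}}(1-\varphi_u)^{-1}y_u-M_2(1-z_l)$ for all $l\in\{r+1,\dots,|\mathcal{U}|\}$; - $t_l\ge0$ for all $l\in\{r+1,\dots,|\mathcal{U}|\}$, where $M_2=|\mathcal{U}|\,(1-\max_{u\in\mathcal{U}}\varphi_u)^{-1}$. Convention: if $(\mathcal{P})$ is infeasible, then $z^*_{(\mathcal{P})}=+\infty$ and $1/z^*_{(\mathcal{P})}=0$. *)

theory Defs
  imports Complex_Main "HOL-Library.Extended_Real"
begin

(* Conventions: U is the set of components, X the set of sensor locations, mon x the
   monitoring set of x, phi u the security level of u, r the number of sensors. *)

definition set_cover :: "'u set \<Rightarrow> 'x set \<Rightarrow> ('x \<Rightarrow> 'u set) \<Rightarrow> 'x set \<Rightarrow> bool" where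
  "set_cover U X mon C \<longleftrightarrow> C \<subseteq> X \<and> (\<Union>x\<in>C. mon x) = U"

definition min_cover_size :: "'u set \<Rightarrow> 'x set \<Rightarrow> ('x \<Rightarrow> 'u set) \<Rightarrow> nat" where
  "min_cover_size U X mon = (LEAST n. \<exists>C. set_cover U X mon C \<and> card C = n)"

definition set_packings :: "'u set \<Rightarrow> 'x set \<Rightarrow> ('x \<Rightarrow> 'u set) \<Rightarrow> 'u set set" where
  "set_packings U X mon = {T. T \<subseteq> U \<and> (\<forall>x\<in>X. card (T \<inter> mon x) \<le> 1)}"

definition packing_weight :: "('u \<Rightarrow> real) \<Rightarrow> 'u set \<Rightarrow> real" where
  "packing_weight phi T = (\<Sum>u\<in>T. inverse (1 - phi u))"

definition packing_value :: "('u \<Rightarrow> real) \<Rightarrow> nat \<Rightarrow> 'u set \<Rightarrow> ereal" where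
  "packing_value phi r T =
     (if T = {} then \<infinity>
      else ereal (1 - (real (card T) - real r) / packing_weight phi T))"

definition big_M2 :: "'u set \<Rightarrow> ('u \<Rightarrow> real) \<Rightarrow> real" where
  "big_M2 U phi = real (card U) * inverse (1 - Max (phi ` U))"

(* The decision variables are total functions; only their values at l \<in> {r+1..card U} and
   u \<in> U are constrained or enter the objective. *)

definition P_feasible ::
  "'u set \<Rightarrow> 'x set \<Rightarrow> ('x \<Rightarrow> 'u set) \<Rightarrow> ('u \<Rightarrow> real) \<Rightarrow> nat
    \<Rightarrow> (nat \<Rightarrow> real) \<Rightarrow> (nat \<Rightarrow> real) \<Rightarrow> ('u \<Rightarrow> real) \<Rightarrow> bool" where
  "P_feasible U X mon phi r t z y \<longleftrightarrow>
     (\<forall>l\<in>{r+1..card U}. z l \<in> {0, 1}) \<and>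
     (\<forall>u\<in>U. y u \<in> {0, 1}) \<and>
     (\<forall>x\<in>X. (\<Sum>u\<in>mon x. y u) \<le> 1) \<and>
     (\<Sum>u\<in>U. y u) = (\<Sum>l\<in>{r+1..card U}. real l * z l) \<and>
     (\<Sum>l\<in>{r+1..card U}. z l) = 1 \<and>
     (\<forall>l\<in>{r+1..card U}.
        t l \<ge> (\<Sum>u\<in>U. inverse (1 - phi u) * y u) - big_M2 U phi * (1 - z l)) \<and>
     (\<forall>l\<in>{r+1..card U}. t l \<ge> 0)"

definition P_objective :: "'u set \<Rightarrow> nat \<Rightarrow> (nat \<Rightarrow> real) \<Rightarrow> real" where
  "P_objective U r t = (\<Sum>l\<in>{r+1..card U}. 1 / (real l - real r) * t l)"

(* An infimum in the extended reals, so the value is \<infinity> if the program is infeasible. *)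

definition P_optimal_value ::
  "'u set \<Rightarrow> 'x set \<Rightarrow> ('x \<Rightarrow> 'u set) \<Rightarrow> ('u \<Rightarrow> real) \<Rightarrow> nat \<Rightarrow> ereal" where
  "P_optimal_value U X mon phi r =
     Inf {ereal (P_objective U r t) | t z y. P_feasible U X mon phi r t z y}"

end

theory Submission
  imports Defs
begin

text \<open>Why the identity holds. A packing \<open>T\<close> with at most \<open>r\<close> elements has value at least 1, so it is
  invisible next to the constant 1 on the left; call the other packings large. For a large
  packing the value is \<open>1 - 1 / \<rho>(T)\<close> with the positive ratio \<open>\<rho>(T) = S\<^sub>T / (|T| - r)\<close>, hence
  minimising the value over large packings amounts to minimising \<open>\<rho>\<close>.

  The program minimises exactly this ratio: \<open>y\<close> is the indicator of a packing \<open>T\<close>, the constraints on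
  \<open>z\<close> single out the index \<open>l = |T|\<close> and thereby force \<open>|T| > r\<close>, and \<open>t\<^sub>l\<close> at that index is at least
  \<open>S\<^sub>T\<close>, so that the objective is at least \<open>\<rho>(T)\<close> (\<open>P_feasible_objective_ge\<close>). Conversely, since
  \<open>S\<^sub>T \<le> M\<^sub>2\<close>, all other \<open>t\<^sub>l\<close> may be 0 and the bound is attained (\<open>P_feasible_of_large_packing\<close>).
  Thus the optimal value is the least ratio of a large packing, which exists as soon as there is a
  large packing, because there are only finitely many; if there is none, the program is
  infeasible and both sides equal 1.\<close>

definition large_packings :: "'u set \<Rightarrow> 'x set \<Rightarrow> ('x \<Rightarrow> 'u set) \<Rightarrow> nat \<Rightarrow> 'u set set" where
  "large_packings U X mon r = {T \<in> set_packings U X mon. r < card T}"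

definition packing_ratio :: "('u \<Rightarrow> real) \<Rightarrow> nat \<Rightarrow> 'u set \<Rightarrow> real" where
  "packing_ratio phi r T = packing_weight phi T / (real (card T) - real r)"

lemma packing_weight_pos:
  assumes "finite T" "T \<noteq> {}" and "\<And>u. u \<in> T \<Longrightarrow> phi u < 1"
  shows "0 < packing_weight phi T"
  unfolding packing_weight_def using assms by (intro sum_pos) auto

lemma packing_ratio_pos:
  assumes "r < card T" and "\<And>u. u \<in> T \<Longrightarrow> phi u < 1"
  shows "0 < packing_ratio phi r T"
proof -
  have "finite T" "T \<noteq> {}"
    using assms(1) by (auto intro: card_ge_0_finite)
  then show ?thesis
    using packing_weight_pos[of T phi] assms by (auto simp: packing_ratio_def)
qed

lemma packing_value_large:
  assumes "r < card T"
  shows "packing_value phi r T = ereal (1 - 1 / packing_ratio phi r T)"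
  using assms by (auto simp: packing_value_def packing_ratio_def)

lemma packing_value_small:
  assumes "finite T" "card T \<le> r" and "\<And>u. u \<in> T \<Longrightarrow> phi u < 1"
  shows "1 \<le> packing_value phi r T"
proof (cases "T = {}")
  case False
  then have "(real (card T) - real r) / packing_weight phi T \<le> 0"
    using packing_weight_pos[of T phi] assms by (intro divide_nonpos_pos) auto
  then show ?thesis
    using False by (simp add: packing_value_def one_ereal_def)
qed (simp add: packing_value_def)

text \<open>Each of the at most \<open>|U|\<close> summands of \<open>S\<^sub>T\<close> is bounded by the one belonging to the largest
  security level. This is what makes \<open>M\<^sub>2\<close> large enough to switch off a constraint on \<open>t\<^sub>l\<close>.\<close>

lemma packing_weight_le_big_M2:
  assumes "finite U" "T \<subseteq> U" and "\<And>u. u \<in> U \<Longrightarrow> phi u < 1"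
  shows "packing_weight phi T \<le> big_M2 U phi"
proof (cases "U = {}")
  case True
  then show ?thesis using assms by (simp add: packing_weight_def big_M2_def)
next
  case False
  have Max_lt: "Max (phi ` U) < 1"
    using False assms by simp
  have "packing_weight phi T \<le> (\<Sum>u\<in>U. inverse (1 - phi u))"
    unfolding packing_weight_def using assms
    by (intro sum_mono2) (auto simp: less_imp_le)
  also have "\<dots> \<le> (\<Sum>u\<in>U. inverse (1 - Max (phi ` U)))"
    using assms(1) Max_lt by (intro sum_mono le_imp_inverse_le) auto
  finally show ?thesis
    by (simp add: big_M2_def)
qed

lemma sum_mult_01_indicator:
  fixes f y :: "'a \<Rightarrow> real"
  assumes "finite A" and "\<And>a. a \<in> A \<Longrightarrow> y a \<in> {0, 1}"
  shows "(\<Sum>a\<in>A. f a * y a) = (\<Sum>a\<in>{a \<in> A. y a = 1}. f a)"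
proof -
  have "(\<Sum>a\<in>A. f a * y a) = (\<Sum>a\<in>A. if y a = 1 then f a else 0)"
    using assms(2) by (intro sum.cong) auto
  then show ?thesis
    using assms(1) by (simp add: sum.inter_filter)
qed

lemma sum_01_card:
  fixes y :: "'a \<Rightarrow> real"
  assumes "finite A" and "\<And>a. a \<in> A \<Longrightarrow> y a \<in> {0, 1}"
  shows "(\<Sum>a\<in>A. y a) = real (card {a \<in> A. y a = 1})"
  using sum_mult_01_indicator[of A y "\<lambda>_. 1"] assms by simp

text \<open>The packing is the support of \<open>y\<close>; by the two equality constraints the only index with
  \<open>z\<^sub>l = 1\<close> is its cardinality, and there the big-M term vanishes. The remaining terms of the
  objective are nonnegative.\<close>

lemma P_feasible_objective_ge:
  assumes fin: "finite U" and mon: "\<And>x. x \<in> X \<Longrightarrow> mon x \<subseteq> U"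
    and feas: "P_feasible U X mon phi r t z y"
  shows "\<exists>T\<in>large_packings U X mon r. packing_ratio phi r T \<le> P_objective U r t"
proof -
  define T where "T = {u \<in> U. y u = 1}"
  let ?L = "{r+1..card U}"
  have z01: "\<And>l. l \<in> ?L \<Longrightarrow> z l \<in> {0, 1}" and y01: "\<And>u. u \<in> U \<Longrightarrow> y u \<in> {0, 1}"
    and pack: "\<And>x. x \<in> X \<Longrightarrow> (\<Sum>u\<in>mon x. y u) \<le> 1"
    and size: "(\<Sum>u\<in>U. y u) = (\<Sum>l\<in>?L. real l * z l)" and one: "(\<Sum>l\<in>?L. z l) = 1"
    and t_ge: "\<And>l. l \<in> ?L \<Longrightarrow>
      (\<Sum>u\<in>U. inverse (1 - phi u) * y u) - big_M2 U phi * (1 - z l) \<le> t l"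
    and t_nonneg: "\<And>l. l \<in> ?L \<Longrightarrow> 0 \<le> t l"
    using feas unfolding P_feasible_def by blast+
  have "card {l \<in> ?L. z l = 1} = 1"
    using sum_01_card[of ?L z] z01 one by simp
  then obtain k where k: "{l \<in> ?L. z l = 1} = {k}"
    by (auto simp: card_1_singleton_iff)
  then have kL: "k \<in> ?L" and zk: "z k = 1"
    by auto
  have "real (card T) = real k"
    using sum_01_card[of U y] fin y01 size sum_mult_01_indicator[of ?L z real] z01 k
    by (simp add: T_def)
  then have cardT: "card T = k"
    by simp
  have "card (T \<inter> mon x) \<le> 1" if "x \<in> X" for x
  proof -
    have "T \<inter> mon x = {u \<in> mon x. y u = 1}"
      using mon[OF that] by (auto simp: T_def)
    moreover have "(\<Sum>u\<in>mon x. y u) = real (card {u \<in> mon x. y u = 1})"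
      using mon[OF that] y01 by (intro sum_01_card finite_subset[OF _ fin]) auto
    ultimately show ?thesis
      using pack[OF that] by simp
  qed
  then have "T \<in> large_packings U X mon r"
    using kL cardT by (auto simp: large_packings_def set_packings_def T_def)
  moreover have "packing_ratio phi r T \<le> P_objective U r t"
  proof -
    have "packing_weight phi T \<le> t k"
      using t_ge[OF kL] zk fin y01 sum_mult_01_indicator[of U y "\<lambda>u. inverse (1 - phi u)"]
      by (simp add: packing_weight_def T_def)
    then have "packing_ratio phi r T \<le> 1 / (real k - real r) * t k"
      using kL cardT by (simp add: packing_ratio_def divide_right_mono)
    also have "\<dots> \<le> P_objective U r t"
      unfolding P_objective_def using kL t_nonneg by (intro member_le_sum) auto
    finally show ?thesis .
  qed
  ultimately show ?thesis
    by blast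
qed

text \<open>The bound is attained by the indicators of \<open>T\<close> and of the index \<open>|T|\<close>, with \<open>S\<^sub>T\<close> as the only
  nonzero \<open>t\<^sub>l\<close>: at every other index \<open>S\<^sub>T - M\<^sub>2 \<le> 0\<close>, so that 0 is allowed.\<close>

lemma P_feasible_of_large_packing:
  assumes fin: "finite U" and mon: "\<And>x. x \<in> X \<Longrightarrow> mon x \<subseteq> U"
    and phi: "\<And>u. u \<in> U \<Longrightarrow> phi u < 1"
    and T: "T \<in> large_packings U X mon r"
  shows "\<exists>t z y. P_feasible U X mon phi r t z y \<and> P_objective U r t = packing_ratio phi r T"
proof -
  let ?L = "{r+1..card U}" and ?k = "card T"
  define y :: "'a \<Rightarrow> real" where "y u = (if u \<in> T then 1 else 0)" for u
  define z :: "nat \<Rightarrow> real" where "z l = (if l = ?k then 1 else 0)" for l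
  define t where "t l = (if l = ?k then packing_weight phi T else 0)" for l
  have TU: "T \<subseteq> U" and pack: "\<And>x. x \<in> X \<Longrightarrow> card (T \<inter> mon x) \<le> 1" and rk: "r < ?k"
    using T by (auto simp: large_packings_def set_packings_def)
  have kL: "?k \<in> ?L"
    using rk TU fin by (auto intro: card_mono)
  have sum_mult_y: "(\<Sum>u\<in>A. f u * y u) = (\<Sum>u\<in>T \<inter> A. f u)" if "A \<subseteq> U" for A and f :: "'a \<Rightarrow> real"
  proof -
    have "{u \<in> A. y u = 1} = T \<inter> A"
      by (auto simp: y_def)
    then show ?thesis
      using sum_mult_01_indicator[OF finite_subset[OF that fin], of y f] by (auto simp: y_def)
  qed
  have sum_y: "(\<Sum>u\<in>A. y u) = real (card (T \<inter> A))" if "A \<subseteq> U" for A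
    using sum_mult_y[OF that, of "\<lambda>_. 1"] by simp
  have weight: "(\<Sum>u\<in>U. inverse (1 - phi u) * y u) = packing_weight phi T"
    using sum_mult_y[of U "\<lambda>u. inverse (1 - phi u)"] TU
    by (simp add: packing_weight_def Int_absorb2)
  have sum_mult_delta: "(\<Sum>l\<in>?L. f l * (if l = ?k then c else 0)) = f ?k * c"
    for f :: "nat \<Rightarrow> real" and c
  proof -
    have "(\<Sum>l\<in>?L. f l * (if l = ?k then c else 0)) = (\<Sum>l\<in>?L. if l = ?k then f l * c else 0)"
      by (intro sum.cong) auto
    then show ?thesis
      using kL by (simp add: sum.delta)
  qed
  have "0 \<le> packing_weight phi T"
    unfolding packing_weight_def using TU phi by (intro sum_nonneg) (auto simp: less_imp_le)
  moreover have "packing_weight phi T \<le> big_M2 U phi"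
    using packing_weight_le_big_M2[OF fin TU phi] .
  moreover have "(\<Sum>u\<in>mon x. y u) \<le> 1" if "x \<in> X" for x
    using sum_y[OF mon[OF that]] pack[OF that] by simp
  moreover have "(\<Sum>u\<in>U. y u) = (\<Sum>l\<in>?L. real l * z l)"
    using sum_y[of U] TU sum_mult_delta[of real 1] by (simp add: z_def Int_absorb2)
  moreover have "(\<Sum>l\<in>?L. z l) = 1"
    using sum_mult_delta[of "\<lambda>_. 1" 1] by (simp add: z_def)
  ultimately have "P_feasible U X mon phi r t z y"
    unfolding P_feasible_def weight by (auto simp: t_def z_def y_def)
  moreover have "P_objective U r t = packing_ratio phi r T"
    unfolding P_objective_def t_def sum_mult_delta by (simp add: packing_ratio_def)
  ultimately show ?thesis
    by blast
qed

lemma P_optimal_value_eq_INF_packing_ratio: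
  assumes "finite U" and "\<And>x. x \<in> X \<Longrightarrow> mon x \<subseteq> U" and "\<And>u. u \<in> U \<Longrightarrow> phi u < 1"
  shows "P_optimal_value U X mon phi r = (INF T\<in>large_packings U X mon r. ereal (packing_ratio phi r T))"
proof (rule antisym)
  show "P_optimal_value U X mon phi r \<le> (INF T\<in>large_packings U X mon r. ereal (packing_ratio phi r T))"
  proof (rule INF_greatest)
    fix T assume "T \<in> large_packings U X mon r"
    then obtain t z y where "P_feasible U X mon phi r t z y"
      and "P_objective U r t = packing_ratio phi r T"
      using P_feasible_of_large_packing[of U X mon phi T r] assms by blast
    then show "P_optimal_value U X mon phi r \<le> ereal (packing_ratio phi r T)"
      unfolding P_optimal_value_def by (metis (mono_tags, lifting) Inf_lower mem_Collect_eq)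
  qed
  show "(INF T\<in>large_packings U X mon r. ereal (packing_ratio phi r T)) \<le> P_optimal_value U X mon phi r"
    unfolding P_optimal_value_def
  proof (rule Inf_greatest, clarify)
    fix t z y assume "P_feasible U X mon phi r t z y"
    then obtain T where "T \<in> large_packings U X mon r" "packing_ratio phi r T \<le> P_objective U r t"
      using P_feasible_objective_ge[of U X mon phi r t z y] assms(1,2) by auto
    then show "(INF T\<in>large_packings U X mon r. ereal (packing_ratio phi r T)) \<le> ereal (P_objective U r t)"
      by (auto intro: INF_lower2)
  qed
qed

theorem proposition2:
  fixes U :: "'u set" and X :: "'x set" and mon :: "'x \<Rightarrow> 'u set"
    and phi :: "'u \<Rightarrow> real" and r :: nat
  assumes "finite U" and "finite X"
    and "\<And>u. u \<in> U \<Longrightarrow> 0 \<le> phi u \<and> phi u < 1"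
    and "\<And>x. x \<in> X \<Longrightarrow> mon x \<noteq> {} \<and> mon x \<subseteq> U"
    and "(\<Union>x\<in>X. mon x) = U"
    and "0 < r" and "r < min_cover_size U X mon"
  shows "min 1 (MIN T\<in>set_packings U X mon. packing_value phi r T)
           = 1 - 1 / P_optimal_value U X mon phi r"
proof -
  let ?P = "set_packings U X mon" and ?L = "large_packings U X mon r"
  have PU: "\<And>T. T \<in> ?P \<Longrightarrow> T \<subseteq> U" and LP: "?L \<subseteq> ?P"
    by (auto simp: set_packings_def large_packings_def)
  have finP: "finite ?P"
    using assms(1) PU by (intro finite_subset[of ?P "Pow U"]) auto
  have small: "1 \<le> packing_value phi r T" if "T \<in> ?P" "T \<notin> ?L" for T
    using that PU[OF that(1)] assms(1,3)
    by (intro packing_value_small) (auto simp: large_packings_def intro: finite_subset)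
  have ratio_pos: "0 < packing_ratio phi r T" if "T \<in> ?L" for T
    using that PU LP assms(3) by (intro packing_ratio_pos) (auto simp: large_packings_def)
  have value_large: "packing_value phi r T = ereal (1 - 1 / packing_ratio phi r T)" if "T \<in> ?L" for T
    using that by (auto simp: large_packings_def packing_value_large)
  have opt: "P_optimal_value U X mon phi r = (INF T\<in>?L. ereal (packing_ratio phi r T))"
    using assms by (intro P_optimal_value_eq_INF_packing_ratio) auto
  show ?thesis
  proof (cases "?L = {}")
    case True
    have "{} \<in> ?P"
      by (simp add: set_packings_def)
    then have "1 \<le> (MIN T\<in>?P. packing_value phi r T)"
      using finP small True by (subst Min_ge_iff) auto
    moreover have "P_optimal_value U X mon phi r = \<infinity>"
      using opt True by (simp add: top_ereal_def)
    ultimately show ?thesis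
      by simp
  next
    case False
    obtain T\<^sub>0 where T\<^sub>0: "T\<^sub>0 \<in> ?L"
      and least: "\<And>T. T \<in> ?L \<Longrightarrow> packing_ratio phi r T\<^sub>0 \<le> packing_ratio phi r T"
      using ex_is_arg_min_if_finite[OF finite_subset[OF LP finP] False, of "packing_ratio phi r"]
      by (auto simp: is_arg_min_linorder)
    have opt_T\<^sub>0: "P_optimal_value U X mon phi r = ereal (packing_ratio phi r T\<^sub>0)"
      unfolding opt using T\<^sub>0 least by (intro antisym INF_greatest INF_lower) auto
    have le_1: "packing_value phi r T\<^sub>0 \<le> 1"
      using value_large[OF T\<^sub>0] ratio_pos[OF T\<^sub>0] by (simp add: one_ereal_def)
    have "packing_value phi r T\<^sub>0 \<le> packing_value phi r T" if "T \<in> ?P" for T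
    proof (cases "T \<in> ?L")
      case True
      then show ?thesis
        using value_large T\<^sub>0 least ratio_pos[OF T\<^sub>0] by (simp add: frac_le)
    next
      case False
      then show ?thesis
        using small[OF that False] le_1 by (meson order_trans)
    qed
    then have "(MIN T\<in>?P. packing_value phi r T) = packing_value phi r T\<^sub>0"
      using finP T\<^sub>0 LP by (intro Min_eqI) auto
    then show ?thesis
      using le_1 value_large[OF T\<^sub>0] opt_T\<^sub>0 ratio_pos[OF T\<^sub>0]
      by (simp add: min_absorb2 one_ereal_def)
  qed
qed

end
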